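(* Let $(\Omega,\mathcal A,P)$ be a probability space, let $\{A_n, n\ge 1\}$ be a sequence of events in $\mathcal A$, and let $\mathcal F\subseteq\mathcal A$ be a sub-$\sigma$-algebra such that $P(A_n\mid\mathcal F)\to 0$ almost surely as $n\to\infty$. Suppose further that $$\sum_{n=1}^\infty P(A_n A_{n+1}^c\mid\mathcal F)<\infty\quad\text{almost surely.}$$ Then $P(\limsup A_n\mid\mathcal F)=0$ almost surely, and hence $P(\limsup A_n)=0$.
   Context: $\limsup A_n=\bigcap_{n=1}^\infty\bigcup_{i=n}^\infty A_i$ is the event that $A_n$ occurs infinitely often. $A^c$ is the complement of $A$, and juxtaposition of events denotes intersection, so $A_nA_{n+1}^c=A_n\cap A_{n+1}^c$. $P(A\mid\mathcal F)=E[\mathbf 1_A\mid\mathcal F]$. *)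

theory Defs
  imports "HOL-Probability.Probability"
begin

text \<open>
  The conditional probability \<open>P(A | F) = E[1\<^sub>A | F]\<close> given a sub-sigma-algebra. As in the
  library, \<open>F\<close> is encoded as a measure with \<open>subalgebra M F\<close>; only its space and sets matter.
  \<open>real_cond_exp\<close> picks one version, so equations about it are meaningful only \<open>M\<close>-almost everywhere.
\<close>
definition prob_given :: "'a measure \<Rightarrow> 'a measure \<Rightarrow> 'a set \<Rightarrow> 'a \<Rightarrow> real" where
  "prob_given M F A = real_cond_exp M F (indicator A)"

text \<open>
  Sequences of events are indexed from 1; the value at index 0 plays no role.
\<close>
definition limsup_events :: "(nat \<Rightarrow> 'a set) \<Rightarrow> 'a set" where
  "limsup_events A = (\<Inter>n\<in>{1..}. \<Union>i\<in>{n..}. A i)"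

text \<open>This agrees with the library's lattice-theoretic limes superior.\<close>
lemma limsup_events_eq_limsup: "limsup_events A = limsup A"
proof -
  have "x \<in> limsup_events A \<longleftrightarrow> (\<forall>n. \<exists>i\<ge>n. x \<in> A i)" for x
  proof
    assume x: "x \<in> limsup_events A"
    show "\<forall>n. \<exists>i\<ge>n. x \<in> A i"
    proof
      fix n
      have "x \<in> (\<Union>i\<in>{Suc n..}. A i)"
        using x unfolding limsup_events_def by (rule INT_D) simp
      then obtain i where "i \<ge> Suc n" "x \<in> A i"
        by blast
      then show "\<exists>i\<ge>n. x \<in> A i"
        by (intro exI[of _ i]) simp
    qed
  next
    assume "\<forall>n. \<exists>i\<ge>n. x \<in> A i"
    then show "x \<in> limsup_events A"
      unfolding limsup_events_def by blast
  qed
  then show ?thesis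
    by (simp add: set_eq_iff limsup_INF_SUP Bex_def)
qed

end

theory Submission
  imports Defs
begin

text \<open>
  By a conditional Borel-Cantelli argument, almost surely only finitely many of the events
  \<open>A\<^sub>n A\<^sub>n\<^sub>+\<^sub>1\<^sup>c\<close> occur. On that almost sure set, a point of \<open>limsup A\<^sub>n\<close> can leave the sequence only
  finitely often, so it lies in \<open>liminf A\<^sub>n\<close>; and \<open>P(liminf A\<^sub>n) \<le> lim P(A\<^sub>n) = 0\<close> because
  \<open>P(A\<^sub>n) = E[P(A\<^sub>n | F)] \<rightarrow> 0\<close> by bounded convergence.
\<close>

context prob_space
begin

lemma sigma_finite_subalgebra:
  assumes "subalgebra M F"
  shows "sigma_finite_subalgebra M F"
  using assms
  by (intro finite_measure_subalgebra_is_sigma_finite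
      finite_measure_subalgebra.intro finite_measure_subalgebra_axioms.intro)
     (simp_all add: finite_measure_axioms)

text \<open>The set integral identity is the averaging property of conditional expectation, which
  requires \<open>G\<close> to be in \<open>sets F\<close>. It converts bounds on conditional
  probabilities into bounds on \<open>prob\<close>.\<close>

lemma
  assumes "subalgebra M F" and "A \<in> events"
  shows integrable_prob_given: "integrable M (prob_given M F A)"
    and set_integral_prob_given:
      "G \<in> sets F \<Longrightarrow> (\<integral>x\<in>G. prob_given M F A x \<partial>M) = prob (G \<inter> A)"
    and prob_given_nonneg: "AE x in M. 0 \<le> prob_given M F A x"
    and prob_given_le_1: "AE x in M. prob_given M F A x \<le> 1"
proof -
  interpret sigma_finite_subalgebra M F
    using assms(1) by (rule sigma_finite_subalgebra)
  have int: "integrable M (indicator A :: 'a \<Rightarrow> real)"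
    using assms(2) by (simp add: integrable_indicator_iff emeasure_eq_measure)
  show "integrable M (prob_given M F A)"
    unfolding prob_given_def using int by (rule real_cond_exp_int)
  show "AE x in M. 0 \<le> prob_given M F A x"
    unfolding prob_given_def using assms(2) by (intro real_cond_exp_pos) auto
  show "AE x in M. prob_given M F A x \<le> 1"
    unfolding prob_given_def using int by (intro real_cond_exp_le_c) (auto simp: indicator_def)
  assume G: "G \<in> sets F"
  then have "(\<integral>x\<in>G. prob_given M F A x \<partial>M) = (\<integral>x\<in>G. indicator A x \<partial>M)"
    unfolding prob_given_def using real_cond_exp_intA[OF int] by simp
  also have "\<dots> = (\<integral>x. indicator (G \<inter> A) x \<partial>M)"
    by (simp add: set_lebesgue_integral_def indicator_inter_arith)
  also have "\<dots> = prob (G \<inter> A)"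
    using G assms subalg sets.sets_into_space[OF assms(2)]
    by (auto simp: subalgebra_def intro!: arg_cong[where f = prob])
  finally show "(\<integral>x\<in>G. prob_given M F A x \<partial>M) = prob (G \<inter> A)" .
qed

text \<open>The indicator of a null set is almost surely zero, and conditional expectation respects
  almost sure equality.\<close>

lemma prob_given_eq_0:
  assumes "subalgebra M F" and "A \<in> null_sets M"
  shows "AE x in M. prob_given M F A x = 0"
proof -
  interpret sigma_finite_subalgebra M F
    using assms(1) by (rule sigma_finite_subalgebra)
  have "AE x in M. indicator A x = (0 :: real)"
    using AE_not_in[OF assms(2)] by eventually_elim simp
  then have "AE x in M. prob_given M F A x = real_cond_exp M F (\<lambda>_. 0) x"
    unfolding prob_given_def using assms(2) by (intro real_cond_exp_cong) auto
  moreover have "AE x in M. real_cond_exp M F (\<lambda>_. 0 :: real) x = 0"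
    by (intro real_cond_exp_F_meas) auto
  ultimately show ?thesis
    by eventually_elim simp
qed

text \<open>
  On the \<open>F\<close>-measurable set where the series of conditional probabilities has partial sums bounded
  by \<open>K\<close>, the unconditional Borel-Cantelli lemma applies; these sets exhaust the space as \<open>K\<close> grows.
\<close>
lemma conditional_borel_cantelli:
  assumes F: "subalgebra M F" and B: "\<And>n. B n \<in> events"
    and sum: "AE x in M. summable (\<lambda>n. prob_given M F (B n) x)"
  shows "AE x in M. \<forall>\<^sub>F n in sequentially. x \<notin> B n"
proof -
  \<comment> \<open>\<open>prob_given\<close> is one fixed \<open>F\<close>-measurable version, so
    \<open>G K\<close> lies in \<open>sets F\<close> and the averaging property applies to
    it.\<close>
  define G where "G K = {x \<in> space F. \<forall>N. (\<Sum>n<N. prob_given M F (B n) x) \<le> real K}" for K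
  have [measurable]: "prob_given M F (B n) \<in> borel_measurable F" for n
    unfolding prob_given_def by (rule borel_measurable_cond_exp)
  have GF: "G K \<in> sets F" for K
    unfolding G_def by measurable
  then have G: "G K \<in> events" for K
    using F unfolding subalgebra_def by blast
  have space: "space F = space M"
    using F unfolding subalgebra_def by blast
  have "AE x in M. \<forall>\<^sub>F n in sequentially. x \<in> space M - (G K \<inter> B n)" for K
  proof (rule borel_cantelli_AE1)
    show "G K \<inter> B n \<in> events" for n
      using G B by blast
    show "emeasure M (G K \<inter> B n) < \<infinity>" for n
      by (simp add: emeasure_eq_measure)
    show "summable (\<lambda>n. prob (G K \<inter> B n))"
    proof (rule summableI_nonneg_bounded)
      fix N
      have int: "set_integrable M (G K) (prob_given M F (B n))" for n
        unfolding set_integrable_def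
        by (intro integrable_mult_indicator G integrable_prob_given[OF F B])
      \<comment> \<open>Averaging turns each probability into an integral over \<open>G K\<close>;
        after exchanging sum and integral, the integrand is a partial sum cut off to
        \<open>G K\<close>.\<close>
      have "(\<Sum>n<N. prob (G K \<inter> B n)) = (\<Sum>n<N. \<integral>x\<in>G K. prob_given M F (B n) x \<partial>M)"
        by (simp add: set_integral_prob_given[OF F B GF])
      also have "\<dots> = (\<integral>x. (\<Sum>n<N. indicator (G K) x *\<^sub>R prob_given M F (B n) x) \<partial>M)"
        unfolding set_lebesgue_integral_def
        by (rule Bochner_Integration.integral_sum[symmetric])
           (use int in \<open>simp add: set_integrable_def\<close>)
      also have "\<dots> \<le> (\<integral>x. real K \<partial>M)"
      proof (rule integral_mono)
        show "integrable M (\<lambda>x. \<Sum>n<N. indicator (G K) x *\<^sub>R prob_given M F (B n) x)"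
          using int by (intro Bochner_Integration.integrable_sum) (simp add: set_integrable_def)
        \<comment> \<open>On \<open>G K\<close> this is its defining bound; elsewhere the sum is
          0.\<close>
        show "(\<Sum>n<N. indicator (G K) x *\<^sub>R prob_given M F (B n) x) \<le> real K" for x
          by (cases "x \<in> G K") (auto simp: G_def)
      qed simp
      also have "\<dots> = real K"
        by (simp add: prob_space)
      finally show "(\<Sum>n<N. prob (G K \<inter> B n)) \<le> real K" .
    qed simp
  qed
  then have "AE x in M. \<forall>K. \<forall>\<^sub>F n in sequentially. x \<in> space M - (G K \<inter> B n)"
    unfolding AE_all_countable by blast
  with sum AE_space show ?thesis
  proof eventually_elim
    case (elim x)
    \<comment> \<open>Convergent partial sums are bounded, so \<open>x\<close> lies in some
      \<open>G K\<close>. This \<open>K\<close> depends on \<open>x\<close>, which is why the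
      exceptional null sets were first merged over all \<open>K\<close>.\<close>
    then have "Bseq (\<lambda>N. \<Sum>n<N. prob_given M F (B n) x)"
      unfolding summable_iff_convergent by (blast intro: convergent_imp_Bseq)
    then obtain C where C: "\<And>N. \<bar>\<Sum>n<N. prob_given M F (B n) x\<bar> \<le> C"
      unfolding Bseq_def by auto
    obtain K where "C \<le> real K"
      using real_arch_simple by blast
    have "(\<Sum>n<N. prob_given M F (B n) x) \<le> real K" for N
      using C[of N] \<open>C \<le> real K\<close> by linarith
    then have "x \<in> G K"
      using elim space by (simp add: G_def)
    with elim(3) show ?case
      by (auto elim!: allE[of _ K] eventually_mono)
  qed
qed

end

theorem theorem1p7:
  fixes M F :: "'a measure" and A :: "nat \<Rightarrow> 'a set"
  assumes "prob_space M"
    and "subalgebra M F"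
    and "\<And>n. n \<ge> 1 \<Longrightarrow> A n \<in> sets M"
    and "AE x in M. (\<lambda>n. prob_given M F (A n) x) \<longlonglongrightarrow> 0"
    and "AE x in M. summable (\<lambda>n. prob_given M F (A (n + 1) \<inter> (space M - A (n + 2))) x)"
  shows "(AE x in M. prob_given M F (limsup_events A) x = 0) \<and>
         measure M (limsup_events A) = 0"
proof -
  interpret prob_space M by fact
  \<comment> \<open>The shift leaves out \<open>A 0\<close>, about which nothing is assumed, so that
    every \<open>C n\<close> is an event.\<close>
  define C where "C n = A (Suc n)" for n
  have C: "C n \<in> events" for n
    using assms(3) by (simp add: C_def)
  have "(\<lambda>n. \<integral>x. prob_given M F (C n) x \<partial>M) \<longlonglongrightarrow> (\<integral>x. 0 \<partial>M)"
  proof (rule integral_dominated_convergence)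
    show "integrable M (\<lambda>_. 1 :: real)"
      by simp
    show "prob_given M F (C n) \<in> borel_measurable M" for n
      using integrable_prob_given[OF assms(2) C] by (rule borel_measurable_integrable)
    show "AE x in M. (\<lambda>n. prob_given M F (C n) x) \<longlonglongrightarrow> 0"
      using assms(4) unfolding C_def by eventually_elim (rule LIMSEQ_Suc)
    show "AE x in M. norm (prob_given M F (C n) x) \<le> 1" for n
      using prob_given_nonneg[OF assms(2) C[of n]] prob_given_le_1[OF assms(2) C[of n]]
      by eventually_elim simp
  qed simp
  moreover have "(\<integral>x. prob_given M F (C n) x \<partial>M) = prob (C n)" for n
  proof -
    \<comment> \<open>Averaging over the whole space gives the law of total probability.\<close>
    have "space M \<in> sets F"
      using assms(2) sets.top[of F] by (simp add: subalgebra_def)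
    from set_integral_prob_given[OF assms(2) C this, of n] show ?thesis
      using integrable_prob_given[OF assms(2) C]
      by (simp add: set_integral_space sets.Int_space_eq1[OF C])
  qed
  ultimately have lim: "(\<lambda>n. prob (C n)) \<longlonglongrightarrow> 0"
    by simp
  have tail: "(\<Inter>n\<in>{k..}. C n) \<in> null_sets M" for k
  proof -
    have meas: "(\<Inter>n\<in>{k..}. C n) \<in> events"
      using C by (intro sets.countable_INT') auto
    \<comment> \<open>The intersection is contained in each \<open>C n\<close> with
      \<open>n \<ge> k\<close>, so its probability is at most the limit of
      \<open>prob (C n)\<close>.\<close>
    have "prob (\<Inter>n\<in>{k..}. C n) \<le> 0"
    proof (rule LIMSEQ_le_const[OF lim])
      show "\<exists>N. \<forall>n\<ge>N. prob (\<Inter>n\<in>{k..}. C n) \<le> prob (C n)"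
        by (intro exI[of _ k] allI impI finite_measure_mono C) auto
    qed
    with meas show ?thesis
      by (intro null_setsI) (auto simp: emeasure_eq_measure intro: antisym)
  qed
  have "AE x in M. \<forall>\<^sub>F n in sequentially. x \<notin> C n \<inter> (space M - C (Suc n))"
  proof (rule conditional_borel_cantelli[OF assms(2)])
    show "C n \<inter> (space M - C (Suc n)) \<in> events" for n
      by (intro sets.Int sets.Diff sets.top C)
  qed (use assms(5) in \<open>simp add: C_def\<close>)
  moreover have "AE x in M. \<forall>k. x \<notin> (\<Inter>n\<in>{k..}. C n)"
    unfolding AE_all_countable using AE_not_in[OF tail] by blast
  ultimately have "AE x in M. x \<notin> limsup_events A"
    using AE_space
  proof eventually_elim
    case (elim x)
    then obtain N where N: "\<And>n. n \<ge> N \<Longrightarrow> x \<in> C n \<Longrightarrow> x \<in> C (Suc n)"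
      by (auto simp: eventually_sequentially)
    show ?case
    proof
      assume "x \<in> limsup_events A"
      \<comment> \<open>Starting at \<open>Suc N\<close> compensates for the shift:
        \<open>A i\<close> is \<open>C (i - 1)\<close> with \<open>i - 1 \<ge> N\<close>.\<close>
      then obtain i where "i \<ge> Suc N" "x \<in> A i"
        unfolding limsup_events_def by force
      then obtain m where m: "m \<ge> N" "x \<in> C m"
        by (cases i) (auto simp: C_def)
      \<comment> \<open>Past \<open>N\<close> the point can no longer leave, so it stays in every
        \<open>C n\<close> from \<open>m\<close> on, against the exclusion of the tail intersection
        at \<open>k = m\<close>.\<close>
      have "x \<in> C n" if "n \<ge> m" for n
        using that m N by (induction rule: dec_induct) auto
      with elim(2) show False
        by blast
    qed
  qed
  moreover have "limsup_events A \<in> events"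
    unfolding limsup_events_def using assms(3)
    by (intro sets.countable_INT' sets.countable_UN') auto
  \<comment> \<open>The unconditional claim comes first; the conditional one follows from it by
    \<open>prob_given_eq_0\<close>.\<close>
  ultimately have "limsup_events A \<in> null_sets M"
    by (simp add: AE_iff_null_sets)
  then show ?thesis
    using prob_given_eq_0[OF assms(2)] by (auto simp: measure_def)
qed

end
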